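(* Let $U:=L^2(\Omega)$ and let the approximation space be $A_j:=\mathrm{span}\{1_{\square_{j,k}}\mid k\in\Gamma_j^\phi\}$, the span of the piecewise constants on the dyadic grid of level $j$, where the supports of the functions $1_{\square_{j,k}}$ define a partition of $\Omega$. Then the EDMD approximation $\mathcal{U}^{edmd}_{j,m}$ of the Koopman operator $\mathcal{U}$, built from the samples $\{(x_\ell,y_\ell)\}_{\ell\le m}$, can be written $$(\mathcal{U}^{edmd}_{j,m}f)(x)=\sum_{k\in\Gamma_j^\phi}p_{j,k}\,1_{\square_{j,k}}(x)$$ for each $f=\sum_{i\in\Gamma_j^\phi}c_i1_{\square_{j,i}}\in A_j$, with $$p_{j,k}:=\begin{cases}\dfrac{\sum_{\ell\le m}\sum_{i\in\Gamma_j^\phi}1_{\square_{j,k}}(x_\ell)\,1_{\square_{j,i}}(y_\ell)\,c_i}{\sum_{s\le m}1_{\square_{j,k}}(x_s)} & \text{if }\{x_s\}_{s\le m}\cap\square_{j,k}\ne\emptyset,\\[2mm] 0 & \text{if }\{x_s\}_{s\le m}\cap\square_{j,k}=\emptyset.\end{cases}$$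
   Context: $\Omega\subset\mathbb{R}$ is compact; $\{\square_{j,k}\}_{k\in\Gamma_j^\phi}$ are the finitely many cells of the dyadic grid with side length $2^{-j}$, forming a partition of $\Omega$, and $1_{\square_{j,k}}$ are their characteristic functions (so $A_j$ is also the span of the Haar scaling functions of level $j$, equivalently of the Haar wavelets up to the corresponding level). Set $n:=n_j:=\dim A_j=\#\Gamma_j^\phi$. The samples $(x_\ell,y_\ell)\in\Omega\times\Omega$, $\ell=1,\dots,m$, are input-output observations of a dynamical system $x_{n+1}=w(x_n)$, $w:\Omega\to\Omega$, whose Koopman operator is $\mathcal{U}f=f\circ w$. EDMD approximation: let $\phi=[\phi_1,\dots,\phi_n]'$ be the column vector of basis functions of $A_j$ (here the functions $1_{\square_{j,k}}$), let $\Phi(\mathbb{X}):=[\phi(x_1),\dots,\phi(x_m)]\in\mathbb{R}^{n\times m}$ and $\Phi(\mathbb{Y}):=[\phi(y_1),\dots,\phi(y_m)]\in\mathbb{R}^{n\times m}$, and let $M:=\Phi(\mathbb{Y})\Phi(\mathbb{X})^\dagger\in\mathbb{R}^{n\times n}$ with $\Phi(\mathbb{X})^\dagger:=\Phi(\mathbb{X})'\big(\Phi(\mathbb{X})\Phi(\mathbb{X})'\big)^\dagger$ the pseudoinverse ($'$ denotes transpose and $\dagger$ the Moore–Penrose pseudoinverse). Then for $f=\sum_{i\le n}c_i\phi_i\in A_j$ with $c=(c_1,\dots,c_n)'\in\mathbb{R}^n$, $$(\mathcal{U}^{edmd}_{j,m}f)(x):=\phi'(x)\,M'\,c.$$ 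*)

theory Defs
  imports "HOL-Analysis.Analysis" "Jordan_Normal_Form.Matrix"
begin

text \<open>
  Elements of \<open>L\<^sup>2(\<Omega>)\<close> are represented by functions; two functions represent the same element
  iff they agree almost everywhere on \<open>\<Omega>\<close> with respect to Lebesgue measure.
\<close>

definition L2 :: "real set \<Rightarrow> (real \<Rightarrow> real) set" where
  "L2 \<Omega> = {f \<in> borel_measurable (lebesgue_on \<Omega>). integrable (lebesgue_on \<Omega>) (\<lambda>z. (f z)\<^sup>2)}"

definition L2_span :: "real set \<Rightarrow> 'i set \<Rightarrow> ('i \<Rightarrow> real \<Rightarrow> real) \<Rightarrow> (real \<Rightarrow> real) set" where
  "L2_span \<Omega> I \<phi> =
     {f \<in> L2 \<Omega>. \<exists>c. AE z in lebesgue_on \<Omega>. f z = (\<Sum>i\<in>I. c i * \<phi> i z)}"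

text \<open>
  The cell with index \<open>k\<close> is the part of \<open>\<Omega>\<close> in the dyadic interval from \<open>k 2\<^sup>-\<^sup>j\<close> to
  \<open>(k + 1) 2\<^sup>-\<^sup>j\<close>. It is left open which of two adjacent cells owns a common end point: no
  nonempty compact set is a finite disjoint union of half-open intervals, so for \<open>[0, 1]\<close> the
  last cell has to be closed. Cells of measure zero are excluded, as their characteristic
  functions vanish in \<open>L\<^sup>2(\<Omega>)\<close> and the span would have dimension smaller than \<open>card \<Gamma>\<close>.
\<close>

definition dyadic_partition :: "real set \<Rightarrow> int \<Rightarrow> int set \<Rightarrow> (int \<Rightarrow> real set) \<Rightarrow> bool" where
  "dyadic_partition \<Omega> j \<Gamma> cell \<longleftrightarrow>
     finite \<Gamma> \<and>
     (\<forall>k\<in>\<Gamma>.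
        \<Omega> \<inter> {of_int k * 2 powi (- j) <..< of_int (k + 1) * 2 powi (- j)} \<subseteq> cell k \<and>
        cell k \<subseteq> {of_int k * 2 powi (- j) .. of_int (k + 1) * 2 powi (- j)} \<and>
        0 < emeasure lebesgue (cell k)) \<and>
     disjoint_family_on cell \<Gamma> \<and>
     (\<Union>k\<in>\<Gamma>. cell k) = \<Omega>"

text \<open>The four Penrose conditions, over the reals.\<close>

definition is_pinv :: "real mat \<Rightarrow> real mat \<Rightarrow> bool" where
  "is_pinv A X \<longleftrightarrow>
     X \<in> carrier_mat (dim_col A) (dim_row A) \<and>
     A * X * A = A \<and> X * A * X = X \<and>
     transpose_mat (A * X) = A * X \<and> transpose_mat (X * A) = X * A"

definition pinv :: "real mat \<Rightarrow> real mat" where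
  "pinv A = (THE X. is_pinv A X)"

text \<open>
  In the following, basis functions \<open>\<phi> i\<close> (\<open>i < n\<close>) and samples \<open>x l\<close>, \<open>y l\<close> (\<open>l < m\<close>) are
  numbered from zero.
\<close>

definition feature_vec :: "nat \<Rightarrow> (nat \<Rightarrow> real \<Rightarrow> real) \<Rightarrow> real \<Rightarrow> real Matrix.vec" where
  "feature_vec n \<phi> z = Matrix.vec n (\<lambda>i. \<phi> i z)"

definition feature_mat ::
    "nat \<Rightarrow> (nat \<Rightarrow> real \<Rightarrow> real) \<Rightarrow> nat \<Rightarrow> (nat \<Rightarrow> real) \<Rightarrow> real mat" where
  "feature_mat n \<phi> m x = Matrix.mat n m (\<lambda>(i, l). \<phi> i (x l))"

definition edmd_mat ::
    "nat \<Rightarrow> (nat \<Rightarrow> real \<Rightarrow> real) \<Rightarrow> nat \<Rightarrow> (nat \<Rightarrow> real) \<Rightarrow> (nat \<Rightarrow> real) \<Rightarrow> real mat" where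
  "edmd_mat n \<phi> m x y =
     (let \<Phi>X = feature_mat n \<phi> m x; \<Phi>Y = feature_mat n \<phi> m y
      in \<Phi>Y * (transpose_mat \<Phi>X * pinv (\<Phi>X * transpose_mat \<Phi>X)))"

text \<open>Well defined for \<open>f\<close> in the span if the \<open>\<phi> i\<close> are linearly independent in \<open>L\<^sup>2(\<Omega>)\<close>.\<close>

definition L2_coords ::
    "real set \<Rightarrow> nat \<Rightarrow> (nat \<Rightarrow> real \<Rightarrow> real) \<Rightarrow> (real \<Rightarrow> real) \<Rightarrow> real Matrix.vec" where
  "L2_coords \<Omega> n \<phi> f =
     (THE c. c \<in> carrier_vec n \<and>
        (AE z in lebesgue_on \<Omega>. f z = (\<Sum>i<n. vec_index c i * \<phi> i z)))"

definition edmd ::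
    "real set \<Rightarrow> nat \<Rightarrow> (nat \<Rightarrow> real \<Rightarrow> real) \<Rightarrow> nat \<Rightarrow> (nat \<Rightarrow> real) \<Rightarrow> (nat \<Rightarrow> real)
       \<Rightarrow> (real \<Rightarrow> real) \<Rightarrow> real \<Rightarrow> real" where
  "edmd \<Omega> n \<phi> m x y f z =
     scalar_prod (feature_vec n \<phi> z)
       (mult_mat_vec (transpose_mat (edmd_mat n \<phi> m x y)) (L2_coords \<Omega> n \<phi> f))"

end

theory Submission
  imports Defs
begin

text \<open>
  At every sample point at most one characteristic function of a cell is nonzero. Hence the Gram
  matrix \<open>\<Phi>(X) \<Phi>(X)'\<close> is diagonal, and its \<open>k\<close>-th diagonal entry counts the samples \<open>x\<^sub>l\<close> in
  cell \<open>k\<close> (\<open>gram_mat_disjoint\<close>). The pseudoinverse of a diagonal matrix inverts the nonzero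
  entries and keeps the zeros (\<open>pinv_mat_diag\<close>), so multiplication by it divides the \<open>k\<close>-th column of
  \<open>\<Phi>(Y) \<Phi>(X)'\<close>, which counts the observed transitions from cell \<open>k\<close> to each cell, by the number of visits
  to cell \<open>k\<close>. The \<open>k\<close>-th entry of \<open>M' c\<close> is therefore the quotient \<open>p\<^sub>k\<close>
  (\<open>edmd_mat_disjoint\<close>, \<open>edmd_disjoint\<close>). If no sample visits cell \<open>k\<close>, the zero left by the pseudoinverse
  gives the second case in the definition of \<open>p\<^sub>k\<close>.

  It remains to see that the coefficients of \<open>f\<close> used by EDMD are the given ones. Both
  represent \<open>f\<close> almost everywhere only, which suffices because every cell has
  positive measure: two linear combinations that agree almost everywhere agree at some
  point of each cell (\<open>L2_coords_eqI\<close>).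
\<close>

section \<open>Pseudoinverses of diagonal matrices\<close>

text \<open>
  The Penrose conditions make \<open>A X\<close> and \<open>A Y\<close> symmetric with \<open>A X = (A Y) (A X)\<close>; transposing
  reverses the product, so \<open>A X = (A X) (A Y) = A Y\<close>. In the same way \<open>X A = Y A\<close>, and then
  \<open>X = X A X = X A Y = Y A Y = Y\<close>.
\<close>

lemma is_pinv_unique:
  assumes X: "is_pinv A X" and Y: "is_pinv A Y"
  shows "X = Y"
proof -
  define r c where "r = dim_row A" and "c = dim_col A"
  have cA: "A \<in> carrier_mat r c" and cX: "X \<in> carrier_mat c r" and cY: "Y \<in> carrier_mat c r"
    using X Y by (auto simp: is_pinv_def r_def c_def)
  have AX: "A * X \<in> carrier_mat r r" and AY: "A * Y \<in> carrier_mat r r"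
    and XA: "X * A \<in> carrier_mat c c" and YA: "Y * A \<in> carrier_mat c c"
    using cA cX cY by auto
  have pX: "A * X * A = A" "X * A * X = X"
      "transpose_mat (A * X) = A * X" "transpose_mat (X * A) = X * A"
    and pY: "A * Y * A = A" "Y * A * Y = Y"
      "transpose_mat (A * Y) = A * Y" "transpose_mat (Y * A) = Y * A"
    using X Y by (auto simp: is_pinv_def)
  have "A * X = (A * Y) * (A * X)"
    using pY(1) assoc_mult_mat[OF AY cA cX] by simp
  also have "\<dots> = transpose_mat ((A * X) * (A * Y))"
    using transpose_mult[OF AX AY] pX(3) pY(3) by simp
  also have "(A * X) * (A * Y) = A * Y"
    using pX(1) assoc_mult_mat[OF AX cA cY] by simp
  finally have eq1: "A * X = A * Y"
    using pY(3) by simp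
  have "X * A = (X * A) * (Y * A)"
    using pY(1) assoc_mult_mat[OF cX cA YA] assoc_mult_mat[OF cA cY cA] by simp
  also have "\<dots> = transpose_mat ((Y * A) * (X * A))"
    using transpose_mult[OF YA XA] pX(4) pY(4) by simp
  also have "(Y * A) * (X * A) = Y * A"
    using pX(1) assoc_mult_mat[OF cY cA XA] assoc_mult_mat[OF cA cX cA] by simp
  finally have eq2: "X * A = Y * A"
    using pY(4) by simp
  have "X = X * (A * X)"
    using pX(2) assoc_mult_mat[OF cX cA cX] by simp
  also have "\<dots> = X * A * Y"
    using eq1 assoc_mult_mat[OF cX cA cY] by simp
  also have "\<dots> = Y"
    using eq2 pY(2) by simp
  finally show ?thesis .
qed

lemma pinv_eqI: "is_pinv A X \<Longrightarrow> pinv A = X"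
  unfolding pinv_def by (rule the_equality) (auto intro: is_pinv_unique)

text \<open>The convention \<open>inverse 0 = 0\<close> makes the zero entries come out right.\<close>

lemma pinv_mat_diag: "pinv (mat_diag n d) = mat_diag n (\<lambda>i. inverse (d i))"
proof (rule pinv_eqI)
  have sym: "transpose_mat (mat_diag n e) = mat_diag n e" for e :: "nat \<Rightarrow> real"
    by (intro eq_matI) (auto simp: mat_diag_def)
  have dim: "dim_row (mat_diag n e) = n" "dim_col (mat_diag n e) = n" for e :: "nat \<Rightarrow> real"
    by (auto simp: mat_diag_def)
  have "d i * inverse (d i) * d i = d i" "inverse (d i) * d i * inverse (d i) = inverse (d i)" for i
    by (cases "d i = 0"; simp)+
  then show "is_pinv (mat_diag n d) (mat_diag n (\<lambda>i. inverse (d i)))"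
    unfolding is_pinv_def mat_diag_diag sym dim by (simp only: mat_diag_dim simp_thms)
qed

section \<open>The EDMD matrix of characteristic functions of disjoint sets\<close>

lemma gram_mat_disjoint:
  assumes "disjoint_family_on C {..<n}"
  shows "feature_mat n (\<lambda>i. indicator (C i)) m x
      * transpose_mat (feature_mat n (\<lambda>i. indicator (C i)) m x)
    = mat_diag n (\<lambda>i. \<Sum>s<m. indicator (C i) (x s))"
proof -
  have diag: "indicator (C i) t * indicator (C k) t
      = (if i = k then indicator (C k) t else (0 :: real))" if "i < n" "k < n" for i k and t :: real
    using assms that by (auto simp: disjoint_family_on_def indicator_def)
  show ?thesis
    by (intro eq_matI) (auto simp: feature_mat_def mat_diag_def scalar_prod_def diag lessThan_atLeast0)
qed

text \<open>
  The entries are the empirical transition frequencies of Ulam's method. Column \<open>k\<close> vanishes if no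
  sample visits \<open>C k\<close>, because \<open>a / 0 = 0\<close>.
\<close>

lemma edmd_mat_disjoint:
  assumes "disjoint_family_on C {..<n}"
  shows "edmd_mat n (\<lambda>i. indicator (C i)) m x y = Matrix.mat n n (\<lambda>(i, k).
    (\<Sum>l<m. indicator (C k) (x l) * indicator (C i) (y l)) / (\<Sum>s<m. indicator (C k) (x s)))"
proof -
  define X where "X = feature_mat n (\<lambda>i. indicator (C i)) m x"
  define Y where "Y = feature_mat n (\<lambda>i. indicator (C i)) m y"
  have cX: "transpose_mat X \<in> carrier_mat m n"
    by (simp add: X_def feature_mat_def)
  have "edmd_mat n (\<lambda>i. indicator (C i)) m x y
      = Y * (transpose_mat X * mat_diag n (\<lambda>i. inverse (\<Sum>s<m. indicator (C i) (x s))))"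
    unfolding edmd_mat_def Let_def gram_mat_disjoint[OF assms] pinv_mat_diag
    by (simp add: X_def Y_def)
  then show ?thesis
    unfolding mat_diag_mult_right[OF cX]
    by (intro eq_matI) (auto simp: X_def Y_def feature_mat_def scalar_prod_def lessThan_atLeast0
        divide_inverse sum_distrib_left sum_distrib_right ac_simps)
qed

lemma edmd_disjoint:
  assumes "disjoint_family_on C {..<n}"
    and "L2_coords \<Omega> n (\<lambda>i. indicator (C i)) f = Matrix.vec n v"
  shows "edmd \<Omega> n (\<lambda>i. indicator (C i)) m x y f z =
    (\<Sum>k<n. (\<Sum>l<m. \<Sum>i<n. indicator (C k) (x l) * indicator (C i) (y l) * v i)
      / (\<Sum>s<m. indicator (C k) (x s)) * indicator (C k) z)"
proof -
  have swap: "(\<Sum>i<n. (\<Sum>l<m. indicator (C k) (x l) * indicator (C i) (y l)) / b * v i)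
      = (\<Sum>l<m. \<Sum>i<n. indicator (C k) (x l) * indicator (C i) (y l) * v i) / b" for k and b :: real
  proof -
    have "(\<Sum>i<n. (\<Sum>l<m. indicator (C k) (x l) * indicator (C i) (y l)) / b * v i)
        = (\<Sum>i<n. \<Sum>l<m. indicator (C k) (x l) * indicator (C i) (y l) * v i) / b"
      by (simp only: sum_divide_distrib sum_distrib_right times_divide_eq_left)
    then show ?thesis
      by (simp only: sum.swap[of _ "{..<n}"])
  qed
  have expand: "scalar_prod (feature_vec n \<phi> z)
        (mult_mat_vec (transpose_mat (Matrix.mat n n (\<lambda>(i, k). M i k))) (Matrix.vec n v))
      = (\<Sum>k<n. (\<Sum>i<n. M i k * v i) * \<phi> k z)" for \<phi> M
    by (simp add: feature_vec_def scalar_prod_def mult.commute lessThan_atLeast0)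
  show ?thesis
    unfolding edmd_def edmd_mat_disjoint[OF assms(1)] assms(2) expand swap ..
qed

section \<open>Coefficients with respect to disjoint sets of positive measure\<close>

text \<open>
  The function \<open>emeasure\<close> is zero outside the \<open>\<sigma>\<close>-algebra, so positivity of the measures
  makes the sets \<open>C i\<close> measurable. An equation that holds almost everywhere on \<open>\<Omega>\<close>
  then holds at some point of each \<open>C i\<close>, where both sums reduce to their \<open>i\<close>-th coefficient.
\<close>

lemma L2_coords_eqI:
  assumes \<Omega>: "\<Omega> \<in> sets lebesgue"
    and disj: "disjoint_family_on C {..<n}"
    and sub: "\<And>i. i < n \<Longrightarrow> C i \<subseteq> \<Omega>"
    and pos: "\<And>i. i < n \<Longrightarrow> 0 < emeasure lebesgue (C i)"
    and f: "AE z in lebesgue_on \<Omega>. f z = (\<Sum>i<n. v i * indicator (C i) z)"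
  shows "L2_coords \<Omega> n (\<lambda>i. indicator (C i)) f = Matrix.vec n v"
  unfolding L2_coords_def
proof (rule the_equality)
  show "Matrix.vec n v \<in> carrier_vec n \<and>
      (AE z in lebesgue_on \<Omega>. f z = (\<Sum>i<n. vec_index (Matrix.vec n v) i * indicator (C i) z))"
    using f by simp
next
  fix u
  assume u: "u \<in> carrier_vec n \<and>
      (AE z in lebesgue_on \<Omega>. f z = (\<Sum>i<n. vec_index u i * indicator (C i) z))"
  have local: "(\<Sum>k<n. a k * indicator (C k) z) = a i"
    if "z \<in> C i" "i < n" for a :: "nat \<Rightarrow> real" and i z
  proof -
    have "(\<Sum>k<n. a k * indicator (C k) z) = (\<Sum>k<n. if k = i then a k else (0 :: real))"
      using disj that by (intro sum.cong) (auto simp: disjoint_family_on_def indicator_def)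
    then show ?thesis
      using that by simp
  qed
  have "AE z in lebesgue_on \<Omega>.
      (\<Sum>i<n. vec_index u i * indicator (C i) z) = (\<Sum>i<n. v i * indicator (C i) z)"
    using f u by auto
  then have ae: "AE z in lebesgue. z \<in> \<Omega> \<longrightarrow>
      (\<Sum>i<n. vec_index u i * indicator (C i) z) = (\<Sum>i<n. v i * indicator (C i) z)"
    using \<Omega> by (simp add: AE_restrict_space_iff)
  have "vec_index u i = v i" if i: "i < n" for i
  proof (rule ccontr)
    assume ne: "vec_index u i \<noteq> v i"
    have "AE z in lebesgue. z \<notin> C i"
      using ae by eventually_elim (use ne i sub local in fastforce)
    moreover have "C i \<in> sets lebesgue"
      using pos[OF i] by (intro emeasure_neq_0_sets) auto
    ultimately have "C i \<in> null_sets lebesgue"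
      by (simp add: AE_iff_null_sets)
    then show False
      using pos[OF i] by auto
  qed
  then show "u = Matrix.vec n v"
    using u by (intro eq_vecI) auto
qed

section \<open>EDMD on a dyadic partition\<close>

theorem theorem8p4:
  fixes \<Omega> :: "real set" and j :: int and \<Gamma> :: "int set" and cell :: "int \<Rightarrow> real set"
    and enum :: "nat \<Rightarrow> int" and w :: "real \<Rightarrow> real"
    and m :: nat and x y :: "nat \<Rightarrow> real"
    and f :: "real \<Rightarrow> real" and c :: "int \<Rightarrow> real" and p :: "int \<Rightarrow> real"
  assumes "compact \<Omega>"
    and "dyadic_partition \<Omega> j \<Gamma> cell"
    and "bij_betw enum {..<card \<Gamma>} \<Gamma>"
    and "w ` \<Omega> \<subseteq> \<Omega>"
    and "\<And>l. l < m \<Longrightarrow> x l \<in> \<Omega>"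
    and "\<And>l. l < m \<Longrightarrow> y l = w (x l)"
    and "f \<in> L2_span \<Omega> \<Gamma> (\<lambda>k. indicator (cell k))"
    and "AE z in lebesgue_on \<Omega>. f z = (\<Sum>i\<in>\<Gamma>. c i * indicator (cell i) z)"
    and "\<And>k. p k =
           (if x ` {..<m} \<inter> cell k \<noteq> {}
            then (\<Sum>l<m. \<Sum>i\<in>\<Gamma>. indicator (cell k) (x l) * indicator (cell i) (y l) * c i)
                   / (\<Sum>s<m. indicator (cell k) (x s))
            else 0)"
  shows "\<forall>z\<in>\<Omega>. edmd \<Omega> (card \<Gamma>) (\<lambda>i. indicator (cell (enum i))) m x y f z =
           (\<Sum>k\<in>\<Gamma>. p k * indicator (cell k) z)"
proof
  fix z assume "z \<in> \<Omega>"
  let ?n = "card \<Gamma>" and ?C = "\<lambda>i. cell (enum i)"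
  have img: "enum i \<in> \<Gamma>" if "i < ?n" for i
    using assms(3) that by (auto simp: bij_betw_def)
  have reindex: "(\<Sum>i<?n. g (enum i)) = (\<Sum>k\<in>\<Gamma>. g k)" for g :: "int \<Rightarrow> real"
    by (rule sum.reindex_bij_betw[OF assms(3)])
  have dis: "disjoint_family_on cell \<Gamma>" and un: "(\<Union>k\<in>\<Gamma>. cell k) = \<Omega>"
    and pos: "\<And>k. k \<in> \<Gamma> \<Longrightarrow> 0 < emeasure lebesgue (cell k)"
    using assms(2) by (auto simp: dyadic_partition_def)
  have disC: "disjoint_family_on ?C {..<?n}"
    using dis assms(3) by (auto simp: disjoint_family_on_def bij_betw_def inj_on_def) blast
  have "L2_coords \<Omega> ?n (\<lambda>i. indicator (?C i)) f = Matrix.vec ?n (\<lambda>i. c (enum i))"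
  proof (rule L2_coords_eqI[OF _ disC])
    show "\<Omega> \<in> sets lebesgue"
      using assms(1) by (simp add: borel_compact)
    show "AE z in lebesgue_on \<Omega>. f z = (\<Sum>i<?n. c (enum i) * indicator (?C i) z)"
      using assms(8) by (simp only: reindex[of "\<lambda>k. c k * indicator (cell k) _"])
  qed (use img un pos in auto)
  note edmd_disjoint[OF disC this, of m x y z]
  also have "(\<Sum>k<?n. (\<Sum>l<m. \<Sum>i<?n. indicator (?C k) (x l) * indicator (?C i) (y l) * c (enum i))
        / (\<Sum>s<m. indicator (?C k) (x s)) * indicator (?C k) z)
      = (\<Sum>k\<in>\<Gamma>. (\<Sum>l<m. \<Sum>i\<in>\<Gamma>. indicator (cell k) (x l) * indicator (cell i) (y l) * c i)
        / (\<Sum>s<m. indicator (cell k) (x s)) * indicator (cell k) z)"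
    by (subst reindex[symmetric], subst reindex[symmetric]) simp
  also have "\<dots> = (\<Sum>k\<in>\<Gamma>. p k * indicator (cell k) z)"
  proof (rule sum.cong[OF refl])
    fix k
    have "indicator (cell k) (x s) = (0 :: real)" if "x ` {..<m} \<inter> cell k = {}" "s < m" for s
      using that by (auto simp: indicator_def)
    then show "(\<Sum>l<m. \<Sum>i\<in>\<Gamma>. indicator (cell k) (x l) * indicator (cell i) (y l) * c i)
        / (\<Sum>s<m. indicator (cell k) (x s)) * indicator (cell k) z = p k * indicator (cell k) z"
      unfolding assms(9) by simp
  qed
  finally show "edmd \<Omega> ?n (\<lambda>i. indicator (?C i)) m x y f z
      = (\<Sum>k\<in>\<Gamma>. p k * indicator (cell k) z)" .
qed

end
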